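(* There exists a positive constant $c$ such that for all real $x \ge 2$, \[ V(x) \le c\, \frac{x}{(\ln x)^{0.2587966}}, \] where $V(x)$ denotes the number of positive integers smaller than $x$ that are of the form $\varphi(n)$ for some positive integer $n$, and $\varphi$ is Euler's totient function.
   Context: Euler's function $\varphi(n)$ is the number of integers in $\{1,\dots,n\}$ coprime with $n$. The set $V$ of Euler's values is $\{\varphi(n) : n \in \mathbf{N}\}$, and $V(x)$ is the number of elements of $V$ smaller than $x$. *)

theory Defs
  imports Complex_Main "HOL-Number_Theory.Totient"
begin

definition euler_values :: "nat set" where
  "euler_values = {totient n | n. n > 0}"

definition euler_values_count :: "real \<Rightarrow> nat" where
  "euler_values_count x = card {v \<in> euler_values. real v < x}"

end

theory Submission
  imports Defs "HOL-Number_Theory.Prime_Powers" "HOL-Analysis.Harmonic_Numbers"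
begin

text \<open>
  If \<open>n\<close> has more than \<open>k\<close> distinct prime factors, at least \<open>k\<close> of them are odd and \<open>2 ^ k\<close> divides
  \<open>\<phi>(n)\<close>; at most \<open>x / 2 ^ k\<close> values below \<open>x\<close> arise in this way. If \<open>n\<close> has at most \<open>k\<close> distinct prime
  factors, then \<open>n \<le> (k + 1) \<phi>(n)\<close>, so it suffices to count the \<open>n \<le> (k + 1) x\<close> with \<open>\<omega>(n) \<le> k\<close>.
  Rankin's trick bounds their number by \<open>a\<close> to the power \<open>-k\<close> times \<open>\<Sum>a ^ \<omega>(n)\<close>, for any
  \<open>0 < a \<le> 1\<close>, and this sum over \<open>n \<le> N\<close> is \<open>O(N (ln N) powr (a - 1))\<close> by the upper bounds of
  Chebyshev and Mertens. Taking \<open>k \<approx> a ln (ln x)\<close> and optimising over \<open>a\<close> gives the exponent.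
\<close>

section \<open>Chebyshev and Mertens upper bounds\<close>

text \<open>Substituting \<open>n = d * m\<close> turns the divisor pairs into the lattice points
  under a hyperbola.\<close>

lemma sum_divisors_eq:
  fixes F :: "nat \<Rightarrow> nat \<Rightarrow> 'a::comm_monoid_add"
  shows "(\<Sum>n=1..N. \<Sum>d | d dvd n. F d (n div d)) = (\<Sum>d=1..N. \<Sum>m=1..N div d. F d m)"
proof -
  have "(\<Sum>n=1..N. \<Sum>d | d dvd n. F d (n div d)) =
        (\<Sum>(n,d)\<in>(SIGMA n:{1..N}. {d. d dvd n}). F d (n div d))"
    by (rule sum.Sigma) auto
  also have "\<dots> = (\<Sum>(d,m)\<in>(SIGMA d:{1..N}. {1..N div d}). F d m)"
  proof (rule sum.reindex_bij_witness[of _ "\<lambda>(d,m). (d * m, d)" "\<lambda>(n,d). (d, n div d)"], goal_cases)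
    case (2 a)
    then obtain d k where "a = (d * k, d)" "1 \<le> d * k" "d * k \<le> N"
      by (auto elim!: dvdE)
    moreover from this have "0 < d" "0 < k" by (auto intro!: Nat.gr0I)
    moreover from calculation have "d \<le> N"
      using le_trans[of d "d * k" N] by simp
    moreover have "k \<le> N div d"
      using calculation by (simp add: less_eq_div_iff_mult_less_eq mult.commute)
    ultimately show ?case by simp
  next
    case (4 b)
    thus ?case
      by (auto simp: less_eq_div_iff_mult_less_eq mult.commute intro!: Suc_leI)
  qed auto
  also have "\<dots> = (\<Sum>d=1..N. \<Sum>m=1..N div d. F d m)"
    by (rule sum.Sigma [symmetric]) auto
  finally show ?thesis .
qed

text \<open>The same lattice points with the cofactor \<open>m\<close> outside, so that the inner
  sum over \<open>d\<close> can become \<open>chebyshev_psi (N div m)\<close>.\<close>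

lemma sum_divisors_eq':
  fixes F :: "nat \<Rightarrow> nat \<Rightarrow> 'a::comm_monoid_add"
  shows "(\<Sum>n=1..N. \<Sum>d | d dvd n. F d (n div d)) = (\<Sum>m=1..N. \<Sum>d=1..N div m. F d m)"
proof -
  have "(\<Sum>d=1..N. \<Sum>m=1..N div d. F d m) =
        (\<Sum>d=1..N. \<Sum>m | m \<in> {1..N} \<and> d * m \<le> N. F d m)"
  proof (intro sum.cong refl)
    fix d assume d: "d \<in> {1..N}"
    hence "m \<le> N" if "d * m \<le> N" for m
      using that le_trans[of m "d * m" N] by simp
    with d show "{1..N div d} = {m. m \<in> {1..N} \<and> d * m \<le> N}"
      by (auto simp: less_eq_div_iff_mult_less_eq mult.commute)
  qed
  also have "\<dots> = (\<Sum>m=1..N. \<Sum>d | d \<in> {1..N} \<and> d * m \<le> N. F d m)"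
    by (rule sum.swap_restrict) auto
  also have "\<dots> = (\<Sum>m=1..N. \<Sum>d=1..N div m. F d m)"
  proof (intro sum.cong refl)
    fix d assume d: "d \<in> {1..N}"
    hence "m \<le> N" if "m * d \<le> N" for m
      using that le_trans[of m "m * d" N] by simp
    with d show "{m. m \<in> {1..N} \<and> m * d \<le> N} = {1..N div d}"
      by (auto simp: less_eq_div_iff_mult_less_eq mult.commute)
  qed
  finally show ?thesis by (simp only: sum_divisors_eq)
qed

definition chebyshev_psi :: "nat \<Rightarrow> real" where
  "chebyshev_psi N = (\<Sum>d=1..N. mangoldt d)"

text \<open>Legendre's formula: \<open>d\<close> divides exactly \<open>N div d\<close> of the
  numbers from 1 to \<open>N\<close>.\<close>

lemma ln_fact_eq: "ln (fact N :: real) = (\<Sum>d=1..N. mangoldt d * real (N div d))"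
proof -
  have "ln (fact N :: real) = (\<Sum>n=1..N. ln (real n))"
    unfolding fact_prod of_nat_prod by (rule ln_prod) auto
  also have "\<dots> = (\<Sum>n=1..N. \<Sum>d | d dvd n. mangoldt d)"
    by (intro sum.cong) (auto simp: mangoldt_sum)
  also have "\<dots> = (\<Sum>d=1..N. mangoldt d * real (N div d))"
    using sum_divisors_eq[of "\<lambda>d _. mangoldt d :: real" N] by (simp add: mult.commute)
  finally show ?thesis .
qed

text \<open>Chebyshev's argument: the central binomial coefficient is at most \<open>4 ^ n\<close>,
  and in its logarithm \<open>mangoldt d\<close> has the weight
  \<open>2 * n div d - 2 * (n div d)\<close>, which is never negative and is at least 1 for n < d <=
  2n.\<close>

lemma chebyshev_psi_double: "chebyshev_psi (2 * n) - chebyshev_psi n \<le> 2 * real n"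
proof -
  have le: "real (n div d) * 2 + (if n < d then 1 else 0) \<le> real (2 * n div d)"
    if "d \<in> {1..2*n}" for d
  proof -
    have "2 * (n div d) \<le> 2 * n div d"
      using that by (simp add: less_eq_div_iff_mult_less_eq mult.assoc)
    moreover have "2 * n div d \<ge> 1" "n div d = 0" if "n < d"
      using that \<open>d \<in> _\<close> by (auto simp: Suc_le_eq div_greater_zero_iff)
    ultimately show ?thesis by (auto simp flip: of_nat_mult)
  qed
  have "chebyshev_psi (2*n) - chebyshev_psi n = (\<Sum>d=1..2*n. mangoldt d * (if n < d then 1 else 0))"
  proof -
    have "{1..2*n} = {1..n} \<union> {n+1..2*n}" by auto
    hence "chebyshev_psi (2*n) = chebyshev_psi n + (\<Sum>d=n+1..2*n. mangoldt d)"
      unfolding chebyshev_psi_def by (subst sum.union_disjoint [symmetric]) auto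
    also have "(\<Sum>d=n+1..2*n. mangoldt d :: real) = (\<Sum>d=1..2*n. mangoldt d * (if n < d then 1 else 0))"
      by (rule sum.mono_neutral_cong_left) auto
    finally show ?thesis by simp
  qed
  also have "\<dots> \<le> (\<Sum>d=1..2*n. mangoldt d * (real (2 * n div d) - 2 * real (n div d)))"
    using le by (intro sum_mono mult_left_mono mangoldt_nonneg) (force simp: algebra_simps)
  also have "\<dots> = ln (fact (2*n)) - 2 * (\<Sum>d=1..2*n. mangoldt d * real (n div d))"
    by (simp add: ln_fact_eq algebra_simps sum_subtractf sum_distrib_left)
  also have "(\<Sum>d=1..2*n. mangoldt d * real (n div d)) = ln (fact n)"
    unfolding ln_fact_eq by (rule sum.mono_neutral_right) auto
  also have "ln (fact (2*n) :: real) - 2 * ln (fact n) = ln (real (2 * n choose n))"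
  proof -
    have "real (2 * n choose n) = fact (2 * n) / (fact n * fact n)"
      by (subst binomial_fact) (simp_all add: mult_2)
    thus ?thesis by (simp add: ln_div ln_mult)
  qed
  also have "\<dots> \<le> ln (2 ^ (2 * n))"
  proof (subst ln_le_cancel_iff)
    have "2 * n choose n \<le> 2 ^ (2 * n)"
      by (rule binomial_le_pow2)
    thus "real (2 * n choose n) \<le> 2 ^ (2 * n)"
      by simp
  qed auto
  also have "\<dots> = 2 * real n * ln 2" by (simp add: ln_realpow)
  also have "\<dots> \<le> 2 * real n * 1"
    using ln_2_less_1 by (intro mult_left_mono) auto
  finally show ?thesis by simp
qed

lemma chebyshev_psi_le: "chebyshev_psi n \<le> 4 * real n"
proof (induction n rule: less_induct)
  case (less n)
  show ?case
  proof (cases "n \<le> 1")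
    case True
    thus ?thesis by (cases "n = 0") (auto simp: chebyshev_psi_def le_Suc_eq)
  next
    case False
    define m where "m = n div 2"
    \<comment> \<open>4m by induction plus 2m by doubling. The gap up to 8m leaves room for the last
      term of an odd \<open>n\<close>, which is at most 2m.\<close>
    have IH: "chebyshev_psi (2 * m) \<le> 6 * real m"
      using less.IH[of m] chebyshev_psi_double[of m] False by (auto simp: m_def)
    show ?thesis
    proof (cases "even n")
      case True
      thus ?thesis using IH by (auto simp: m_def elim!: evenE)
    next
      case odd: False
      hence n: "n = Suc (2 * m)" by (auto simp: m_def elim!: oddE)
      have "mangoldt n \<le> ln (real n)" using False by (intro mangoldt_le) auto
      also have "\<dots> \<le> real n - 1" using False by (intro ln_le_minus_one) auto
      also have "\<dots> = 2 * real m" by (simp add: n)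
      finally have "chebyshev_psi n \<le> chebyshev_psi (2 * m) + 2 * real m"
        by (simp add: n chebyshev_psi_def)
      thus ?thesis using IH by (simp add: n)
    qed
  qed
qed

text \<open>Replacing \<open>N / d\<close> by \<open>N div d\<close> costs at most psi(N) <= 4N in
  total; what remains is ln(N!) <= N ln N.\<close>

lemma sum_mangoldt_div_le:
  assumes "N \<ge> 1"
  shows "(\<Sum>d=1..N. mangoldt d / real d) \<le> ln (real N) + 4"
proof -
  have "real N * (\<Sum>d=1..N. mangoldt d / real d) = (\<Sum>d=1..N. mangoldt d * (real N / real d))"
    by (simp add: sum_distrib_left mult_ac)
  also have "\<dots> \<le> (\<Sum>d=1..N. mangoldt d * (real (N div d) + 1))"
  proof (intro sum_mono mult_left_mono mangoldt_nonneg)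
    fix d have "real (N div d) = of_int \<lfloor>real N / real d\<rfloor>"
      by (simp add: floor_divide_of_nat_eq)
    thus "real N / real d \<le> real (N div d) + 1"
      by linarith
  qed
  also have "\<dots> = ln (fact N) + chebyshev_psi N"
    by (simp add: ln_fact_eq chebyshev_psi_def algebra_simps sum.distrib)
  also have "chebyshev_psi N \<le> 4 * real N" by (rule chebyshev_psi_le)
  also have "ln (fact N :: real) \<le> ln (real N ^ N)"
    using assms fact_le_power[of N, where 'a = real] by (subst ln_le_cancel_iff) (auto)
  also have "\<dots> = real N * ln (real N)" using assms by (simp add: ln_realpow)
  finally have "real N * (\<Sum>d=1..N. mangoldt d / real d) \<le> real N * (ln (real N) + 4)"
    by (simp add: algebra_simps)
  thus ?thesis using assms by simp
qed

text \<open>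
  Abel summation; the integral \<open>\<integral>dt / (t ln t)\<close> is telescoped through
  \<open>1 - u / v \<le> ln v - ln u\<close> with \<open>u = ln N\<close> and \<open>v = ln (N + 1)\<close>.
\<close>
lemma sum_div_ln_le:
  fixes a :: "nat \<Rightarrow> real"
  assumes "C \<ge> 0"
  assumes A: "\<And>N. N \<ge> 2 \<Longrightarrow> (\<Sum>n=2..N. a n) \<le> ln (real N) + C"
  assumes "N \<ge> 2"
  shows "(\<Sum>n=2..N. a n / ln (real n)) \<le> ln (ln (real N)) - ln (ln 2) + 1 + C / ln 2"
proof -
  have "(\<Sum>n=2..N. a n / ln (real n)) \<le> (\<Sum>n=2..N. a n) / ln (real N) +
          ln (ln (real N)) - ln (ln 2) + C * (1 / ln 2 - 1 / ln (real N))"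
    using \<open>N \<ge> 2\<close>
  proof (induction N rule: dec_induct)
    case base
    thus ?case by simp
  next
    case (step N)
    define l l' where "l = ln (real N)" and "l' = ln (real (Suc N))"
    have l: "0 < l" "l < l'" using step.hyps by (auto simp: l_def l'_def)
    have "ln (l / l') \<le> l / l' - 1" using l by (intro ln_le_minus_one) auto
    hence *: "1 - l / l' \<le> ln l' - ln l" using l by (simp add: ln_div)
    have "(\<Sum>n=2..N. a n) * (1 / l - 1 / l') \<le> (l + C) * (1 / l - 1 / l')"
      using A[of N] step.hyps l by (intro mult_right_mono) (auto simp: l_def [symmetric] intro!: divide_left_mono)
    also have "\<dots> = 1 - l / l' + C * (1 / l - 1 / l')"
      using l by (simp add: field_simps)
    also note *
    finally have "(\<Sum>n=2..N. a n) * (1 / l - 1 / l') \<le> ln l' - ln l + C * (1 / l - 1 / l')" by simp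
    moreover have "(\<Sum>n=2..Suc N. a n) = (\<Sum>n=2..N. a n) + a (Suc N)"
       "(\<Sum>n=2..Suc N. a n / ln (real n)) = (\<Sum>n=2..N. a n / ln (real n)) + a (Suc N) / l'"
      using step.hyps by (auto simp: l'_def)
    ultimately show ?case using step.IH
      unfolding l_def [symmetric] l'_def [symmetric] by (simp add: algebra_simps add_divide_distrib)
  qed
  also have "(\<Sum>n=2..N. a n) / ln (real N) \<le> (ln (real N) + C) / ln (real N)"
    using A[of N] assms by (intro divide_right_mono) auto
  also have "\<dots> = 1 + C / ln (real N)" using assms by (simp add: field_simps)
  finally show ?thesis by (simp add: algebra_simps)
qed

text \<open>Partial summation applied to \<open>sum_mangoldt_div_le\<close>, whence the 4; proper
  prime powers only add nonnegative terms.\<close>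

lemma sum_inverse_primes_le:
  assumes "N \<ge> 2"
  shows "(\<Sum>p | prime p \<and> p \<le> N. 1 / real p) \<le> ln (ln (real N)) - ln (ln 2) + 1 + 4 / ln 2"
proof -
  have "(\<Sum>n=2..N. mangoldt n / real n / ln (real n)) \<le> ln (ln (real N)) - ln (ln 2) + 1 + 4 / ln 2"
  proof (rule sum_div_ln_le)
    fix N :: nat assume "N \<ge> 2"
    have "(\<Sum>n=2..N. mangoldt n / real n) \<le> (\<Sum>n=1..N. mangoldt n / real n)"
      by (intro sum_mono2) (auto intro: divide_nonneg_nonneg mangoldt_nonneg)
    with sum_mangoldt_div_le[of N] \<open>N \<ge> 2\<close>
      show "(\<Sum>n=2..N. mangoldt n / real n) \<le> ln (real N) + 4" by simp
  qed (use assms in auto)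
  moreover have "(\<Sum>p | prime p \<and> p \<le> N. 1 / real p) \<le> (\<Sum>n=2..N. mangoldt n / real n / ln (real n))"
  proof -
    have "(\<Sum>p | prime p \<and> p \<le> N. 1 / real p) = (\<Sum>p | prime p \<and> p \<le> N. mangoldt p / real p / ln (real p))"
      by (intro sum.cong) (auto dest: prime_gt_1_nat)
    also have "\<dots> \<le> (\<Sum>n=2..N. mangoldt n / real n / ln (real n))"
      by (intro sum_mono2) (auto intro!: divide_nonneg_nonneg mangoldt_nonneg dest: prime_ge_2_nat)
    finally show ?thesis .
  qed
  ultimately show ?thesis by simp
qed

section \<open>The mean value of \<open>z ^ \<omega>(n)\<close>\<close>

text \<open>A finite Euler product: since \<omega> counts \<open>p\<close> once whatever its
  exponent, the local factor is 1 + z (1/p + 1/p^2 + ...) = 1 + z/(p - 1).\<close>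

lemma euler_product_bound:
  assumes "finite P" "\<And>p. p \<in> P \<Longrightarrow> prime (p::nat)" "finite S" "0 \<le> z"
  assumes "\<And>n. n \<in> S \<Longrightarrow> n > 0 \<and> prime_factors n \<subseteq> P"
  shows "(\<Sum>n\<in>S. z ^ card (prime_factors n) / real n) \<le> (\<Prod>p\<in>P. 1 + z / (real p - 1))"
  using assms
proof (induction P arbitrary: S rule: finite_induct)
  case empty
  have "n = 1" if "n \<in> S" for n
    using empty.prems(4)[OF that] by (auto simp: prime_factorization_empty_iff)
  hence "S \<subseteq> {1}" by auto
  hence "S = {} \<or> S = {1}" by auto
  thus ?case by auto
next
  case (insert p P)
  have p: "prime p" using insert.prems by simp
  hence p1: "real p > 1" using prime_gt_1_nat by auto
  \<comment> \<open>\<open>g\<close> splits off the power of \<open>p\<close>, and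
    \<open>w k\<close> is the contribution of \<open>p ^ k\<close>.\<close>
  define g where "g = (\<lambda>n. (multiplicity p n, n div p ^ multiplicity p n))"
  define w where "w = (\<lambda>k::nat. (if k = 0 then 1 else z) * (1 / real p) ^ k)"
  define f where "f = (\<lambda>n. z ^ card (prime_factors n) / real n)"
  define T where "T = (\<lambda>n. n div p ^ multiplicity p n) ` S"
  define K where "K = Max (multiplicity p ` S)"
  have g: "n = p ^ fst (g n) * snd (g n)" for n
    by (simp add: g_def multiplicity_dvd)
  have pf: "f n = w (fst (g n)) * f (snd (g n)) \<and> snd (g n) > 0 \<and> prime_factors (snd (g n)) \<subseteq> P"
    if "n \<in> S" for n
  proof -
    define k m where "k = fst (g n)" and "m = snd (g n)"
    have n: "n = p ^ k * m" using g[of n] by (simp add: k_def m_def)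
    have "n > 0" using insert.prems(4)[OF that] by simp
    hence m: "m > 0" using n by (auto intro!: Nat.gr0I)
    have ndvd: "\<not> p dvd m"
      using \<open>n > 0\<close> p unfolding m_def g_def snd_conv
      by (intro multiplicity_decompose) (auto simp: prime_nat_iff)
    have "prime_factors n = prime_factors (p ^ k) \<union> prime_factors m"
      using m p by (simp add: n prime_factors_product prime_gt_0_nat)
    also have "prime_factors (p ^ k) = (if k = 0 then {} else {p})"
      using p by (auto simp: prime_factors_power prime_prime_factors)
    finally have eq: "prime_factors n = (if k = 0 then {} else {p}) \<union> prime_factors m" .
    have "p \<notin> prime_factors m" using ndvd by auto
    hence "f n = w k * f m"
      by (auto simp: f_def eq w_def) (auto simp: n field_simps)
    moreover have "prime_factors m \<subseteq> P"
      using eq insert.prems(4)[OF that] \<open>p \<notin> prime_factors m\<close> by auto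
    ultimately show ?thesis using m unfolding k_def m_def by auto
  qed
  have inj: "inj_on g S" by (intro inj_onI) (metis g)
  have "finite T" using insert.prems by (auto simp: T_def)
  have T: "m > 0 \<and> prime_factors m \<subseteq> P" if "m \<in> T" for m
    using that pf unfolding T_def g_def by auto
  have f0: "f n \<ge> 0" and w0: "w n \<ge> 0" for n
    using insert.prems by (auto simp: f_def w_def)
  have "(\<Sum>n\<in>S. f n) = (\<Sum>n\<in>S. w (fst (g n)) * f (snd (g n)))"
    using pf by (intro sum.cong) auto
  also have "\<dots> = (\<Sum>(k,m)\<in>g ` S. w k * f m)"
    by (subst sum.reindex[OF inj]) (simp add: case_prod_unfold)
  \<comment> \<open>The pairs need not fill this rectangle, but the terms are nonnegative and the
    enlarged sum factors.\<close>
  also have "\<dots> \<le> (\<Sum>(k,m)\<in>{..K} \<times> T. w k * f m)"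
    using insert.prems \<open>finite T\<close> f0 w0
    by (intro sum_mono2) (auto simp: g_def K_def T_def)
  also have "\<dots> = (\<Sum>k\<le>K. w k) * (\<Sum>m\<in>T. f m)"
    by (simp add: sum_product sum.cartesian_product)
  also have "(\<Sum>k\<le>K. w k) \<le> 1 + z / (real p - 1)"
  proof -
    have "(\<Sum>k\<le>K. w k) = 1 + z * (1 - (1 / real p) ^ K) / (real p - 1)"
    proof (induction K)
      case 0
      thus ?case by (simp add: w_def)
    next
      case (Suc K)
      have "w (Suc K) * (real p - 1) = z * ((1 / real p) ^ K - (1 / real p) ^ Suc K)"
        using p1 by (simp add: w_def field_simps)
      hence "w (Suc K) = z * ((1 / real p) ^ K - (1 / real p) ^ Suc K) / (real p - 1)"
        using p1 by (simp add: eq_divide_eq)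
      thus ?case
        unfolding sum.atMost_Suc Suc.IH
        by (simp add: add_divide_distrib [symmetric] ring_distribs diff_divide_distrib)
    qed
    also have "\<dots> \<le> 1 + z * 1 / (real p - 1)"
      using p1 insert.prems by (intro add_left_mono divide_right_mono mult_left_mono) auto
    finally show ?thesis by simp
  qed
  also have "(\<Sum>m\<in>T. f m) \<le> (\<Prod>p\<in>P. 1 + z / (real p - 1))"
    unfolding f_def by (intro insert.IH) (use insert.prems \<open>finite T\<close> T in auto)
  finally show ?case
    using insert.hyps p1 insert.prems f0
    by (simp add: f_def mult_left_mono mult_right_mono sum_nonneg)
qed

text \<open>The differences 1/(n - 1) - 1/n over all integers from 2 on telescope to at most 1,
  which is the loss against \<open>sum_inverse_primes_le\<close>.\<close>

lemma sum_inverse_pred_primes_le: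
  assumes "N \<ge> 2"
  shows "(\<Sum>p | prime p \<and> p \<le> N. 1 / (real p - 1)) \<le> ln (ln (real N)) - ln (ln 2) + 2 + 4 / ln 2"
proof -
  have tele: "(\<Sum>n=2..N. 1 / (real n - 1) - 1 / real n) = 1 - 1 / real N"
    using assms by (induction N rule: dec_induct) auto
  have "(\<Sum>p | prime p \<and> p \<le> N. 1 / (real p - 1) - 1 / real p) \<le>
        (\<Sum>n=2..N. 1 / (real n - 1) - 1 / real n)"
    by (intro sum_mono2) (auto intro!: divide_left_mono dest: prime_ge_2_nat)
  also note tele
  also have "1 - 1 / real N \<le> 1" by simp
  finally have "(\<Sum>p | prime p \<and> p \<le> N. 1 / (real p - 1)) \<le> (\<Sum>p | prime p \<and> p \<le> N. 1 / real p) + 1"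
    by (simp add: sum_subtractf)
  with sum_inverse_primes_le[OF assms] show ?thesis by simp
qed

text \<open>The Euler product over the primes up to \<open>N\<close> is bounded by 1 + t <= exp t;
  the ln(ln N) of the prime sum then becomes the power of ln N.\<close>

lemma sum_power_omega_div_le:
  fixes z :: real
  assumes "0 \<le> z"
  shows "\<exists>K>0. \<forall>N\<ge>2. (\<Sum>n=1..N. z ^ card (prime_factors n) / real n) \<le> K * ln (real N) powr z"
proof (intro exI conjI allI impI)
  define B where "B = 2 + 4 / ln 2 - ln (ln 2 :: real)"
  show "exp (z * B) > 0" by simp
  fix N :: nat assume N: "N \<ge> 2"
  define P where "P = {p::nat. prime p \<and> p \<le> N}"
  have fin: "finite P" unfolding P_def by (rule finite_subset[of _ "{..N}"]) auto
  have "(\<Sum>n=1..N. z ^ card (prime_factors n) / real n) \<le> (\<Prod>p\<in>P. 1 + z / (real p - 1))"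
    by (rule euler_product_bound)
       (use assms fin in \<open>auto simp: P_def prime_factors_dvd dest!: dvd_imp_le\<close>)
  also have "\<dots> \<le> (\<Prod>p\<in>P. exp (z / (real p - 1)))"
    using assms by (intro prod_mono) (auto simp: P_def dest: prime_gt_1_nat)
  also have "\<dots> = exp (z * (\<Sum>p\<in>P. 1 / (real p - 1)))"
    by (simp add: exp_sum fin sum_distrib_left)
  also have "\<dots> \<le> exp (z * (ln (ln (real N)) + B))"
    using sum_inverse_pred_primes_le[OF N] assms
    by (auto simp: P_def B_def intro!: mult_left_mono)
  also have "\<dots> = exp (z * B) * ln (real N) powr z"
    using N by (simp add: powr_def ring_distribs exp_add)
  finally show "(\<Sum>n=1..N. z ^ card (prime_factors n) / real n) \<le> exp (z * B) * ln (real N) powr z" .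
qed

text \<open>
  Since \<open>f n = z ^ \<omega>(n)\<close> does not increase under multiplication, writing \<open>ln n\<close> as a sum of von
  Mangoldt values bounds \<open>\<Sum>f n ln n\<close> by \<open>\<Sum>f m \<psi>(N / m)\<close>, hence by a multiple of \<open>N \<Sum>f m / m\<close>;
  the remaining part \<open>\<Sum>f n ln (N / n)\<close> is bounded by the same sum.
\<close>
lemma sum_power_omega_le:
  fixes z :: real
  assumes "0 \<le> z" "z \<le> 1"
  shows "\<exists>K>0. \<forall>N\<ge>2. (\<Sum>n=1..N. z ^ card (prime_factors n)) \<le> K * real N * ln (real N) powr (z - 1)"
proof -
  define f where "f = (\<lambda>n::nat. z ^ card (prime_factors n))"
  have f0: "f n \<ge> 0" for n using assms by (simp add: f_def)
  have anti: "f (d * m) \<le> f m" if "d > 0" "m > 0" for d m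
    unfolding f_def using assms that
    by (intro power_decreasing card_mono) (auto simp: prime_factors_product)
  obtain K where K: "K > 0" "\<And>N. N \<ge> 2 \<Longrightarrow> (\<Sum>n=1..N. f n / real n) \<le> K * ln (real N) powr z"
    using sum_power_omega_div_le[OF assms(1)] unfolding f_def by blast
  show ?thesis
  proof (intro exI[of _ "5 * K"] conjI allI impI)
    fix N :: nat assume N: "N \<ge> 2"
    hence lnN: "ln (real N) > 0" by simp
    have "(\<Sum>n=1..N. f n * ln (real n)) = (\<Sum>n=1..N. \<Sum>d | d dvd n. mangoldt d * f (d * (n div d)))"
    proof (intro sum.cong refl)
      fix n assume n: "n \<in> {1..N}"
      have "f n * ln (real n) = (\<Sum>d | d dvd n. mangoldt d * f n)"
        using n by (simp add: mangoldt_sum mult.commute flip: sum_distrib_right)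
      also have "\<dots> = (\<Sum>d | d dvd n. mangoldt d * f (d * (n div d)))"
        by (intro sum.cong) auto
      finally show "f n * ln (real n) = \<dots>" .
    qed
    also have "\<dots> = (\<Sum>m=1..N. \<Sum>d=1..N div m. mangoldt d * f (d * m))"
      by (rule sum_divisors_eq')
    also have "\<dots> \<le> (\<Sum>m=1..N. \<Sum>d=1..N div m. mangoldt d * f m)"
      by (intro sum_mono mult_left_mono anti mangoldt_nonneg) auto
    also have "\<dots> = (\<Sum>m=1..N. chebyshev_psi (N div m) * f m)"
      by (simp add: chebyshev_psi_def sum_distrib_right)
    also have "\<dots> \<le> (\<Sum>m=1..N. 4 * (real N / real m) * f m)"
    proof (intro sum_mono mult_right_mono f0)
      fix m
      have "real (N div m) \<le> real N / real m" by (rule of_nat_div_le_of_nat)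
      with chebyshev_psi_le[of "N div m"] show "chebyshev_psi (N div m) \<le> 4 * (real N / real m)" by linarith
    qed
    finally have 1: "(\<Sum>n=1..N. f n * ln (real n)) \<le> 4 * real N * (\<Sum>n=1..N. f n / real n)"
      by (simp add: sum_distrib_left mult_ac)
    have 2: "(\<Sum>n=1..N. f n * (ln (real N) - ln (real n))) \<le> (\<Sum>n=1..N. f n * (real N / real n))"
    proof (intro sum_mono mult_left_mono f0)
      fix n assume "n \<in> {1..N}"
      hence "ln (real N) - ln (real n) = ln (real N / real n)" by (simp add: ln_div)
      also have "\<dots> \<le> real N / real n - 1"
        using \<open>n \<in> _\<close> by (intro ln_le_minus_one) auto
      finally show "ln (real N) - ln (real n) \<le> real N / real n" by simp
    qed
    \<comment> \<open>The weights ln n and ln N - ln n add up to ln N, and 5 = 4 + 1.\<close>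
    have "(\<Sum>n=1..N. f n) * ln (real N) \<le> 5 * real N * (\<Sum>n=1..N. f n / real n)"
    proof -
      have "(\<Sum>n=1..N. f n * (real N / real n)) = real N * (\<Sum>n=1..N. f n / real n)"
        by (simp add: sum_distrib_left mult_ac)
      moreover have "(\<Sum>n=1..N. f n * (ln (real N) - ln (real n))) =
          (\<Sum>n=1..N. f n) * ln (real N) - (\<Sum>n=1..N. f n * ln (real n))"
        by (simp add: sum_subtractf right_diff_distrib sum_distrib_right)
      ultimately show ?thesis using 1 2 by linarith
    qed
    also have "\<dots> \<le> 5 * real N * (K * ln (real N) powr z)"
      using K(2)[OF N] by (intro mult_left_mono) auto
    finally have "(\<Sum>n=1..N. f n) \<le> 5 * real N * (K * ln (real N) powr z) / ln (real N)"
      using lnN by (simp add: pos_le_divide_eq)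
    also have "\<dots> = 5 * K * real N * ln (real N) powr (z - 1)"
      using lnN by (simp add: powr_diff)
    finally show "(\<Sum>n=1..N. z ^ card (prime_factors n)) \<le> 5 * K * real N * ln (real N) powr (z - 1)"
      by (simp add: f_def)
  qed (use K in auto)
qed

section \<open>Euler values\<close>

text \<open>
  The \<open>i\<close>-th smallest element of \<open>P\<close> is at least \<open>i + 1\<close>, so the product is bounded below by the
  telescoping product of the \<open>i / (i + 1)\<close>.
\<close>
lemma prod_one_minus_inverse_ge:
  assumes "finite P" "\<And>p. p \<in> P \<Longrightarrow> p \<ge> (2::nat)"
  shows "1 / (real (card P) + 1) \<le> (\<Prod>p\<in>P. 1 - 1 / real p)"
  using assms
proof (induction P rule: finite_linorder_max_induct)
  case empty
  thus ?case by simp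
next
  case (insert b P)
  define k where "k = card P"
  have "P \<subseteq> {2..<b}" using insert by auto
  hence "card P \<le> card {2..<b}" by (intro card_mono) auto
  moreover have "b \<ge> 2" using insert.prems by simp
  ultimately have b: "real b \<ge> real k + 2" by (simp add: k_def)
  have "1 / (real k + 2) = (1 - 1 / (real k + 2)) * (1 / (real k + 1))"
    by (simp add: field_simps)
  also have "\<dots> \<le> (1 - 1 / real b) * (\<Prod>p\<in>P. 1 - 1 / real p)"
    using b insert unfolding k_def
    by (intro mult_mono diff_left_mono divide_left_mono) auto
  finally show ?case using insert.hyps by (auto simp: k_def add_ac)
qed

lemma le_omega_times_totient: "real n \<le> (real (card (prime_factors n)) + 1) * real (totient n)"
proof -
  define k where "k = real (card (prime_factors n)) + 1"
  have k: "k > 0" by (simp add: k_def add_pos_pos)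
  have "1 / k \<le> (\<Prod>p\<in>prime_factors n. 1 - 1 / real p)"
    unfolding k_def by (rule prod_one_minus_inverse_ge) (auto dest: in_prime_factors_imp_prime prime_ge_2_nat)
  hence "real n * (1 / k) \<le> real (totient n)"
    unfolding totient_formula2 by (intro mult_left_mono) auto
  thus ?thesis using k unfolding k_def [symmetric] by (simp add: field_simps)
qed

text \<open>Every odd prime factor \<open>p\<close> supplies an even factor \<open>p - 1\<close>.
  Discarding 2 loses at most one prime, hence the strict inequality.\<close>

lemma two_power_dvd_totient:
  assumes "n > 0" "k < card (prime_factors n)"
  shows "2 ^ k dvd totient n"
proof -
  define Q where "Q = prime_factors n - {2}"
  have "card (prime_factors n) \<le> card (insert 2 Q)" by (intro card_mono) (auto simp: Q_def)
  also have "2 \<notin> Q" "finite Q" by (simp_all add: Q_def)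
  hence "card (insert 2 Q) = card Q + 1" by simp
  finally have "card (prime_factors n) \<le> card Q + 1" .
  hence "(2::nat) ^ k dvd 2 ^ card Q" using assms by (intro le_imp_power_dvd) auto
  also have "2 ^ card Q = (\<Prod>p\<in>Q. 2::nat)" by simp
  also have "\<dots> dvd (\<Prod>p\<in>Q. p ^ (multiplicity p n - 1) * (p - 1))"
  proof (intro prod_dvd_prod dvd_mult)
    fix p assume "p \<in> Q"
    hence "prime p" "p \<noteq> 2" by (auto simp: Q_def)
    thus "2 dvd p - 1" by (simp add: prime_odd_nat prime_ge_2_nat le_neq_implies_less)
  qed
  also have "\<dots> dvd (\<Prod>p\<in>prime_factors n. p ^ (multiplicity p n - 1) * (p - 1))"
    by (intro prod_dvd_prod_subset) (auto simp: Q_def)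
  also have "\<dots> = totient n" using assms by (subst totient_formula1) auto
  finally show ?thesis .
qed

text \<open>Zero, a multiple of every \<open>d\<close>, would spoil the bound; it is not the totient
  of a positive number.\<close>

lemma card_dvd_less_le:
  assumes "d > 0" "x \<ge> 0"
  shows "real (card {v. 0 < v \<and> d dvd v \<and> real v < x}) \<le> x / real d"
proof -
  have "{v. 0 < v \<and> d dvd v \<and> real v < x} \<subseteq> (\<lambda>m. d * m) ` {1..nat \<lfloor>x / real d\<rfloor>}"
  proof
    fix v assume "v \<in> {v. 0 < v \<and> d dvd v \<and> real v < x}"
    then obtain m where v: "v = d * m" and m: "0 < d * m" "real (d * m) < x" by auto
    hence "real m \<le> x / real d" using assms by (simp add: pos_le_divide_eq mult.commute)
    hence "m \<le> nat \<lfloor>x / real d\<rfloor>" by (simp add: le_nat_floor)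
    thus "v \<in> (\<lambda>m. d * m) ` {1..nat \<lfloor>x / real d\<rfloor>}" using m unfolding v by (intro imageI) auto
  qed
  from surj_card_le[OF _ this] have "card {v. 0 < v \<and> d dvd v \<and> real v < x} \<le> nat \<lfloor>x / real d\<rfloor>" by simp
  hence "real (card {v. 0 < v \<and> d dvd v \<and> real v < x}) \<le> real (nat \<lfloor>x / real d\<rfloor>)" by linarith
  also have "\<dots> \<le> x / real d" using assms by simp
  finally show ?thesis .
qed

text \<open>Rankin's trick: as z <= 1, every counted \<open>n\<close> contributes at least
  \<open>z ^ k\<close>.\<close>

lemma card_omega_le:
  fixes z :: real and N :: nat
  assumes "0 < z" "z \<le> 1"
  shows "z ^ k * real (card {n\<in>{1..N}. card (prime_factors n) \<le> k}) \<le> (\<Sum>n=1..N. z ^ card (prime_factors n))"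
proof -
  have "z ^ k * real (card {n\<in>{1..N}. card (prime_factors n) \<le> k}) =
        (\<Sum>n\<in>{n\<in>{1..N}. card (prime_factors n) \<le> k}. z ^ k)" by simp
  also have "\<dots> \<le> (\<Sum>n\<in>{n\<in>{1..N}. card (prime_factors n) \<le> k}. z ^ card (prime_factors n))"
    using assms by (intro sum_mono power_decreasing) auto
  also have "\<dots> \<le> (\<Sum>n=1..N. z ^ card (prime_factors n))"
    using assms by (intro sum_mono2) auto
  finally show ?thesis .
qed

text \<open>The cutoff \<open>N\<close> comes from \<open>le_omega_times_totient\<close>. Values
  taken at arguments with few prime factors are counted through these arguments.\<close>

lemma euler_values_count_le:
  fixes k :: nat
  assumes "x \<ge> 0"
  defines "N \<equiv> nat \<lfloor>(real k + 1) * x\<rfloor>"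
  shows "real (euler_values_count x) \<le>
           x / 2 ^ k + real (card {n\<in>{1..N}. card (prime_factors n) \<le> k})"
proof -
  define A B where "A = {v. 0 < v \<and> 2 ^ k dvd v \<and> real v < x}"
    and "B = {n\<in>{1..N}. card (prime_factors n) \<le> k}"
  have "finite A" by (rule finite_subset[of _ "{..nat \<lceil>x\<rceil>}"]) (auto simp: A_def, linarith)
  have "{v \<in> euler_values. real v < x} \<subseteq> A \<union> totient ` B"
  proof
    fix v assume "v \<in> {v \<in> euler_values. real v < x}"
    then obtain n where n: "n > 0" "v = totient n" "real (totient n) < x"
      by (auto simp: euler_values_def)
    show "v \<in> A \<union> totient ` B"
    proof (cases "card (prime_factors n) \<le> k")
      case True
      have "real n \<le> (real (card (prime_factors n)) + 1) * real (totient n)"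
        by (rule le_omega_times_totient)
      also have "\<dots> \<le> (real k + 1) * x" using True n by (intro mult_mono) auto
      finally have "n \<le> N" unfolding N_def by (rule le_nat_floor)
      with n True show ?thesis by (auto simp: B_def)
    next
      case False
      thus ?thesis using n two_power_dvd_totient[of n k] by (auto simp: A_def)
    qed
  qed
  hence "euler_values_count x \<le> card (A \<union> totient ` B)"
    unfolding euler_values_count_def using \<open>finite A\<close> by (intro card_mono) (auto simp: B_def)
  also have "\<dots> \<le> card A + card (totient ` B)" by (rule card_Un_le)
  also have "card (totient ` B) \<le> card B" by (rule card_image_le) (auto simp: B_def)
  finally have "real (euler_values_count x) \<le> real (card A) + real (card B)" by linarith
  also have "real (card A) \<le> x / 2 ^ k"
    using card_dvd_less_le[of "2 ^ k" x] assms by (simp add: A_def)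
  finally show ?thesis by (simp add: B_def)
qed

text \<open>
  Splitting at \<open>k \<approx> a ln (ln x)\<close>, the values divisible by \<open>2 ^ k\<close> cost the first upper bound on
  \<open>\<delta>\<close>. The second one comes from the arguments with few prime factors and is strict, so that it
  absorbs a factor \<open>ln (ln x)\<close>.
\<close>
lemma euler_values_count_upper_bound:
  fixes a \<delta> :: real
  assumes "0 < a" "a \<le> 1" "0 \<le> \<delta>" "\<delta> \<le> a * ln 2" "\<delta> < 1 - a + a * ln a"
  shows "\<exists>c>0. \<forall>x\<ge>2. real (euler_values_count x) \<le> c * (x / ln x powr \<delta>)"
proof -
  obtain K where K: "K > 0"
    "\<And>N. N \<ge> 2 \<Longrightarrow> (\<Sum>n=1..N. a ^ card (prime_factors n)) \<le> K * real N * ln (real N) powr (a - 1)"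
    using sum_power_omega_le[of a] assms by auto
  define \<epsilon> where "\<epsilon> = 1 - a + a * ln a - \<delta>"
  \<comment> \<open>The 1 pays for the multiples of \<open>2 ^ k\<close>, the other term for
    \<open>M\<close> below.\<close>
  define c where "c = 1 + 3 * K / (a * \<epsilon>)"
  have \<epsilon>: "\<epsilon> > 0" using assms by (simp add: \<epsilon>_def)
  hence c: "c > 1" using K assms by (simp add: c_def)
  \<comment> \<open>The threshold gives L >= 1, so that k + 1 <= a L + 2 can be absorbed into 3
    L.\<close>
  have large: "real (euler_values_count x) \<le> c * (x / ln x powr \<delta>)" if x: "x \<ge> exp (exp 1)" for x
  proof -
    define L where "L = ln (ln x)"
    define k where "k = nat \<lceil>a * L\<rceil>"
    define N where "N = nat \<lfloor>(real k + 1) * x\<rfloor>"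
    have "exp (exp 1) > (1::real)" by simp
    hence "x > 1" using x by linarith
    have lnx: "ln x \<ge> exp 1" using x \<open>x > 1\<close> by (simp add: ln_ge_iff)
    have "ln x > 0" using lnx exp_gt_zero[of "1::real"] by linarith
    hence L: "L \<ge> 1" "ln x = exp L" using lnx by (simp_all add: L_def ln_ge_iff)
    have "a * L > 0" using L assms by simp
    hence "k > 0" by (simp add: k_def)
    hence k: "real k \<ge> 1" "a * L \<le> real k" "real k \<le> a * L + 1"
      using \<open>a * L > 0\<close> unfolding k_def by (simp, linarith, linarith)
    have "2 \<le> exp (1::real)" using exp_ge_add_one_self[of "1::real"] by simp
    also have "exp 1 \<le> exp (exp (1::real))" by simp
    finally have "x \<ge> 2" using x by linarith
    have "2 * x \<le> (real k + 1) * x" using k \<open>x > 1\<close> by (intro mult_right_mono) auto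
    hence N: "real N \<le> (real k + 1) * x" "real N \<ge> x" unfolding N_def using \<open>x > 1\<close> by linarith+
    hence "N \<ge> 2" using \<open>x \<ge> 2\<close> by linarith
    \<comment> \<open>Rounding \<open>a * L\<close> up to \<open>k\<close> costs at most one factor
      \<open>a\<close>.\<close>
    have ak: "a * exp (a * ln a * L) \<le> a ^ k"
    proof -
      have "a * exp (a * ln a * L) = a powr (a * L + 1)"
        using assms by (simp add: powr_def exp_add ring_distribs mult_ac)
      also have "\<dots> \<le> a powr real k" using k assms by (intro powr_mono') auto
      finally show ?thesis using assms by (simp add: powr_realpow)
    qed
    define M where "M = real (card {n\<in>{1..N}. card (prime_factors n) \<le> k})"
    have "M * (a * exp (a * ln a * L)) \<le> M * a ^ k"
      by (intro mult_left_mono ak) (simp add: M_def)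
    also have "\<dots> \<le> (\<Sum>n=1..N. a ^ card (prime_factors n))"
      using card_omega_le[of a k N] assms by (simp add: M_def mult.commute)
    also have "\<dots> \<le> K * real N * ln (real N) powr (a - 1)" by (rule K) fact
    \<comment> \<open>As a - 1 <= 0, ln N may be lowered to ln x.\<close>
    also have "\<dots> \<le> K * ((real k + 1) * x) * ln x powr (a - 1)"
      using K N \<open>x \<ge> 2\<close> \<open>N \<ge> 2\<close> assms
      by (intro mult_mono mult_left_mono powr_mono2') auto
    \<comment> \<open>The factor L brought in by \<open>N\<close> is traded for a small power of ln
      x, covered by the slack \<epsilon>.\<close>
    also have "\<dots> \<le> K * (3 * (exp (\<epsilon> * L) / \<epsilon>) * x) * ln x powr (a - 1)"
    proof -
      have "a * L \<le> L" using assms L by (intro mult_left_le_one_le) auto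
      hence "real k + 1 \<le> 3 * L" using k L by linarith
      also have "\<epsilon> * L \<le> exp (\<epsilon> * L)" using exp_ge_add_one_self[of "\<epsilon> * L"] by linarith
      hence "L \<le> exp (\<epsilon> * L) / \<epsilon>" using \<epsilon> by (simp add: pos_le_divide_eq mult.commute)
      finally show ?thesis using K \<open>x > 1\<close>
        by (intro mult_left_mono mult_right_mono) auto
    qed
    also have "ln x powr (a - 1) = exp (L * (a - 1))" by (simp add: L powr_def)
    also have "K * (3 * (exp (\<epsilon> * L) / \<epsilon>) * x) * exp (L * (a - 1)) =
      3 * K * x / \<epsilon> * exp (\<epsilon> * L + L * (a - 1))" by (simp add: exp_add)
    also have "\<epsilon> * L + L * (a - 1) = a * ln a * L - \<delta> * L" by (simp add: \<epsilon>_def algebra_simps)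
    also have "exp \<dots> = exp (a * ln a * L) / exp (\<delta> * L)" by (rule exp_diff)
    finally have "M * a * exp (a * ln a * L) \<le> 3 * K * x / \<epsilon> / exp (\<delta> * L) * exp (a * ln a * L)"
      by (simp add: mult_ac)
    hence "M * a \<le> 3 * K * x / \<epsilon> / exp (\<delta> * L)"
      by (rule mult_right_le_imp_le) simp
    hence "M \<le> 3 * K * x / \<epsilon> / exp (\<delta> * L) / a"
      by (subst pos_le_divide_eq) (use assms in auto)
    hence M: "M \<le> 3 * K / (a * \<epsilon>) * (x / exp (\<delta> * L))"
      by (simp add: mult_ac)
    have "exp (\<delta> * L) \<le> 2 ^ k"
    proof -
      have "\<delta> * L \<le> a * ln 2 * L" using assms L by (intro mult_right_mono) auto
      also have "\<dots> = a * L * ln 2" by simp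
      also have "\<dots> \<le> real k * ln 2" using k by (intro mult_right_mono) auto
      finally have "exp (\<delta> * L) \<le> exp (real k * ln 2)" by simp
      thus ?thesis by (simp add: exp_of_nat_mult)
    qed
    hence "x / 2 ^ k \<le> x / exp (\<delta> * L)" using \<open>x > 1\<close> by (intro divide_left_mono) auto
    with M have "x / 2 ^ k + M \<le> c * (x / exp (\<delta> * L))" by (simp add: c_def algebra_simps)
    also have "exp (\<delta> * L) = ln x powr \<delta>" by (simp add: L powr_def)
    finally show ?thesis
      using euler_values_count_le[of x k] \<open>x > 1\<close> by (simp add: M_def N_def)
  qed
  \<comment> \<open>On this bounded range V(x) <= x suffices, because ln x <= e.\<close>
  have small: "real (euler_values_count x) \<le> exp \<delta> * (x / ln x powr \<delta>)" if x: "2 \<le> x" "x \<le> exp (exp 1)" for x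
  proof -
    have "{v \<in> euler_values. real v < x} \<subseteq> {v. 0 < v \<and> 1 dvd v \<and> real v < x}"
      by (auto simp: euler_values_def)
    moreover have "finite {v. 0 < v \<and> 1 dvd v \<and> real v < x}"
      by (rule finite_subset[of _ "{..nat \<lceil>x\<rceil>}"]) (auto, linarith)
    ultimately have "real (euler_values_count x) \<le> real (card {v. 0 < v \<and> 1 dvd v \<and> real v < x})"
      unfolding euler_values_count_def by (intro of_nat_mono card_mono)
    also have "\<dots> \<le> x" using card_dvd_less_le[of 1 x] x by simp
    finally have le: "real (euler_values_count x) \<le> x" .
    have "ln x \<le> ln (exp (exp 1))" using x by (subst ln_le_cancel_iff) auto
    hence "ln x powr \<delta> \<le> exp 1 powr \<delta>" using assms x by (intro powr_mono2) auto
    also have "\<dots> = exp \<delta>" by (simp add: powr_def)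
    finally have "x * ln x powr \<delta> \<le> x * exp \<delta>" using x by (intro mult_left_mono) auto
    hence "x \<le> exp \<delta> * (x / ln x powr \<delta>)" using x by (simp add: field_simps)
    with le show ?thesis by linarith
  qed
  show ?thesis
  proof (intro exI[of _ "c + exp \<delta>"] conjI allI impI)
    fix x :: real assume x: "x \<ge> 2"
    have nn: "0 \<le> x / ln x powr \<delta>" using x by simp
    have "real (euler_values_count x) \<le> max c (exp \<delta>) * (x / ln x powr \<delta>)"
      using large[of x] small[of x] x mult_right_mono[OF max.cobounded1 nn, of c "exp \<delta>"]
        mult_right_mono[OF max.cobounded2 nn, of "exp \<delta>" c] by linarith
    also have "\<dots> \<le> (c + exp \<delta>) * (x / ln x powr \<delta>)"
      using c by (intro mult_right_mono nn) auto
    finally show "real (euler_values_count x) \<le> (c + exp \<delta>) * (x / ln x powr \<delta>)" .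
  qed (use c in \<open>simp add: add_pos_pos\<close>)
qed

section \<open>Numerical bounds for logarithms\<close>

lemma ln_2_ge: "0.693147178 \<le> ln (2::real)"
  \<comment> \<open>Such precision is needed: 1912/5121 times ln 2 exceeds 0.2587966 by less than
    10^-8.\<close>
  using ln_approx_bounds[of 2 10] by (simp add: lessThan_nat_numeral power_divide)

lemma ln_5121_div_1912_le: "ln (5121 / 1912 :: real) \<le> 0.9852"
  using ln_approx_bounds[of "5121/1912" 10] by (simp add: lessThan_nat_numeral power_divide)


text \<open>
  The two bounds in \<open>euler_values_count_upper_bound\<close> balance at \<open>a \<approx> 0.3733646177\<close>, with common
  value \<open>0.25879663\<dots>\<close>; the fraction \<open>1912 / 5121\<close> is close enough to reach \<open>0.2587966\<close>.
\<close>
theorem theorem1p1: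
  shows "\<exists>c::real. c > 0 \<and>
    (\<forall>x::real. x \<ge> 2 \<longrightarrow>
      real (euler_values_count x) \<le> c * (x / ln x powr 0.2587966))"
proof -
  have "ln (1912 / 5121 :: real) = - ln (5121 / 1912)" by (simp add: ln_div)
  with ln_5121_div_1912_le have "ln (1912 / 5121 :: real) \<ge> - 0.9852" by simp
  with ln_2_ge show ?thesis
    by (intro euler_values_count_upper_bound[of "1912 / 5121"]) simp_all
qed

end
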